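(* Let $q$ be a power of a prime $p$. If there exists a pure $((n,K,R,d))_q$ subsystem code with $R>1$, then there exists a pure $((n,pK,R/p,d))_q$ subsystem code.
   Context: For $(x|y)\in\mathbf{F}_q^{2n}$ (with $x,y\in\mathbf{F}_q^n$), $\mathrm{swt}(x|y)$ is the number of $i$ with $(x_i,y_i)\ne(0,0)$, and $\mathrm{swt}(S)$ is the minimum of $\mathrm{swt}$ over the nonzero elements of $S$. The trace-symplectic product of $(a|b)$ and $(a'|b')$ is $\mathrm{tr}_{q/p}(a'\cdot b-a\cdot b')$, and $C^{\perp_s}$ is the dual of $C\subseteq\mathbf{F}_q^{2n}$ with respect to it. All subsystem codes are Clifford subsystem codes: an $((n,K,R,d))_q$ subsystem code is a subspace $Q=A\otimes B$ of $\mathbf{C}^{q^n}$, $\dim A=K$, $\dim B=R$, arising from an additive code; concretely, its existence means that there is an additive subgroup $C\le\mathbf{F}_q^{2n}$ (the zero code is allowed) with $D=C\cap C^{\perp_s}$ such that $|C|=q^nR/K$, $|D|=q^n/(KR)$, and $d=\mathrm{swt}(D^{\perp_s}\setminus C)$ if $D^{\perp_s}\ne C$, while $d=\mathrm{swt}(D^{\perp_s})$ if $D^{\perp_s}=C$ (the case $K=1$). The code derived from $C$ is pure to $d'$ if $C$ contains no nonzero element of symplectic weight less than $d'$; it is pure if it is pure to its minimum distance $d$. *)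

theory Defs
  imports "HOL-Analysis.Finite_Cartesian_Product" "HOL-Library.Product_Plus"
    "HOL-Computational_Algebra.Primes"
begin

text \<open>
  The field \<open>F\<^sub>q\<close> is a type \<open>'a\<close> of classes \<open>field\<close> and \<open>finite\<close>, the length \<open>n\<close> is
  \<open>CARD('n)\<close>, and \<open>(x|y)\<close> with \<open>x, y \<in> F\<^sub>q\<^sup>n\<close> is the pair \<open>(x, y)\<close>.
\<close>

type_synonym ('a, 'n) dvec = "('a ^ 'n) \<times> ('a ^ 'n)"

text \<open>
  For \<open>q = p ^ m\<close> the trace \<open>tr\<^bsub>q/p\<^esub> x = x + x ^ p + \<dots> + x ^ (p ^ (m - 1))\<close> is taken with values
  in \<open>F\<^sub>q\<close>, inside the prime field; the exponent \<open>m\<close> is recovered as the multiplicity of the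
  characteristic in \<open>q\<close>.
\<close>

definition field_trace :: "'a::{field,finite} \<Rightarrow> 'a" where
  "field_trace x = (\<Sum>i<multiplicity CHAR('a) CARD('a). x ^ (CHAR('a) ^ i))"

definition trace_symplectic ::
    "('a::{field,finite}, 'n::finite) dvec \<Rightarrow> ('a, 'n) dvec \<Rightarrow> 'a" where
  "trace_symplectic u v =
     field_trace (scalar_product (fst v) (snd u) - scalar_product (fst u) (snd v))"

definition symplectic_dual ::
    "('a::{field,finite}, 'n::finite) dvec set \<Rightarrow> ('a, 'n) dvec set" where
  "symplectic_dual C = {u. \<forall>v\<in>C. trace_symplectic u v = 0}"

definition swt :: "('a::zero, 'n::finite) dvec \<Rightarrow> nat" where
  "swt u = card {i. (fst u $ i, snd u $ i) \<noteq> (0, 0)}"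

definition min_swt :: "('a::{zero,finite}, 'n::finite) dvec set \<Rightarrow> nat" where
  "min_swt S = Min (swt ` (S - {0}))"

definition additive_code :: "('a::ab_group_add, 'n::finite) dvec set \<Rightarrow> bool" where
  "additive_code C \<longleftrightarrow>
     0 \<in> C \<and> (\<forall>u\<in>C. \<forall>v\<in>C. u + v \<in> C) \<and> (\<forall>u\<in>C. - u \<in> C)"

text \<open>
  \<open>C\<close> gives rise to an \<open>((n, K, R, d))\<^sub>q\<close> Clifford subsystem code. The set whose minimum weight is
  taken always has a nonzero element: an additive \<open>C\<close> is contained in the dual of
  \<open>D = C \<inter> C\<^sup>\<bottom>\<close>, and this dual is nonzero because \<open>n \<ge> 1\<close>.
\<close>

definition subsystem_code ::
    "('a::{field,finite}, 'n::finite) dvec set \<Rightarrow> nat \<Rightarrow> nat \<Rightarrow> nat \<Rightarrow> bool" where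
  "subsystem_code C K R d \<longleftrightarrow>
     additive_code C \<and> K > 0 \<and> R > 0 \<and>
     (let D = C \<inter> symplectic_dual C in
        real (card C) = real (CARD('a) ^ CARD('n)) * real R / real K \<and>
        real (card D) = real (CARD('a) ^ CARD('n)) / (real K * real R) \<and>
        d = (if symplectic_dual D \<noteq> C then min_swt (symplectic_dual D - C)
             else min_swt (symplectic_dual D)))"

definition pure_to :: "('a::zero, 'n::finite) dvec set \<Rightarrow> nat \<Rightarrow> bool" where
  "pure_to C d' \<longleftrightarrow> \<not> (\<exists>c\<in>C. c \<noteq> 0 \<and> swt c < d')"

definition pure_subsystem_code ::
    "('a::{field,finite}, 'n::finite) dvec set \<Rightarrow> nat \<Rightarrow> nat \<Rightarrow> nat \<Rightarrow> bool" where
  "pure_subsystem_code C K R d \<longleftrightarrow> subsystem_code C K R d \<and> pure_to C d"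

end

theory Submission
  imports Defs "HOL-Computational_Algebra.Polynomial"
begin

text \<open>
  Let \<open>D = C \<inter> C\<^sup>\<bottom>\<close> and \<open>x, y \<in> C\<close> with \<open>\<langle>x, y\<rangle> \<noteq> 0\<close>. Splitting the hyperbolic pair \<open>x, y\<close> off
  \<open>C\<close> leaves \<open>C' = C \<inter> {x, y}\<^sup>\<bottom>\<close>, which has the same radical \<open>D\<close> and index \<open>p\<^sup>2\<close> in \<open>C\<close>. By purity
  all nonzero vectors of \<open>D\<^sup>\<bottom>\<close> have weight at least \<open>d\<close>, so it only remains to keep a vector of
  weight \<open>d\<close> in \<open>D\<^sup>\<bottom> - C'\<close>. This is automatic if \<open>D\<^sup>\<bottom> \<noteq> C\<close>. If \<open>D\<^sup>\<bottom> = C\<close> and some vector of weight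
  \<open>d\<close> lies in \<open>C - D\<close>, choose it as \<open>x\<close>. Otherwise \<open>C - D\<close> has minimum weight larger than \<open>d\<close>, and \<open>C\<close>
  is first moved by the isometry \<open>v \<mapsto> v + \<langle>v, b\<rangle> c + \<langle>v, c\<rangle> b\<close>, where \<open>b\<close> has weight one and is
  not orthogonal to a vector \<open>w \<in> D\<close> of weight \<open>d\<close>, and \<open>c \<in> C - D\<close> is orthogonal to \<open>b\<close>. The
  image still contains \<open>w\<close>, now outside its radical, and weights drop by at most one, and only
  where there is room for it.
\<close>

section \<open>Prime field and trace of a finite field\<close>

lemma prime_CHAR_finite_field: "prime CHAR('a::{field,finite})"
  by (simp add: finite_imp_CHAR_pos prime_CHAR_semidom)

text \<open>Translation by 1 permutes the ring, so it leaves the sum of all elements unchanged; the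
  added ones therefore sum to zero.\<close>

lemma CHAR_dvd_CARD_finite: "CHAR('a::{ring_1,finite}) dvd CARD('a)"
proof -
  have "(\<Sum>x\<in>UNIV. x + 1) = (\<Sum>x\<in>UNIV. x :: 'a)"
    by (rule sum.reindex_bij_witness[of _ "\<lambda>x. x - 1" "\<lambda>x. x + 1"]) auto
  then have "of_nat CARD('a) = (0::'a)"
    by (simp add: sum.distrib)
  then show ?thesis
    by (simp only: of_nat_eq_0_iff_char_dvd)
qed

text \<open>Multiplication by a nonzero \<open>x\<close> permutes the nonzero elements; cancelling
  their product shows that the power of \<open>x\<close> with exponent q - 1 is 1.\<close>

lemma finite_field_power_CARD:
  fixes x :: "'a::{field,finite}"
  shows "x ^ CARD('a) = x"
proof (cases "x = 0")
  case True
  then show ?thesis by (simp add: power_0_left)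
next
  case False
  have "(\<Prod>y\<in>UNIV - {0}. x * y) = (\<Prod>y\<in>UNIV - {0}. y)"
    by (rule prod.reindex_bij_witness[of _ "\<lambda>y. y / x" "\<lambda>y. x * y"]) (use False in auto)
  then have "x ^ (CARD('a) - 1) = 1"
    by (simp add: prod.distrib card_Diff_singleton)
  moreover have "CARD('a) = Suc (CARD('a) - 1)"
    by (simp add: finite_UNIV_card_ge_0)
  ultimately show ?thesis
    by (metis mult.right_neutral power_Suc)
qed

text \<open>In a finite field the natural multiples of 1 already form the prime subfield. In this
  form, closure of additive codes under such scalars is an induction on repeated addition.\<close>

definition prime_field :: "'a::semiring_1 set" where
  "prime_field = range of_nat"

lemma of_nat_power_CHAR:
  "(of_nat n :: 'a::{field,finite}) ^ CHAR('a) = of_nat n"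
proof (induction n)
  case 0
  then show ?case
    using prime_gt_0_nat[OF prime_CHAR_finite_field[where 'a='a]] by (simp add: power_0_left)
next
  case (Suc n)
  then show ?case
    using freshmans_dream[OF prime_CHAR_finite_field refl, of 1 "of_nat n :: 'a"] by simp
qed

lemma card_prime_field: "card (prime_field :: 'a::{field,finite} set) = CHAR('a)"
proof -
  let ?p = "CHAR('a)"
  have p: "?p > 0"
    by (simp add: finite_imp_CHAR_pos)
  have "of_nat n \<in> (of_nat :: nat \<Rightarrow> 'a) ` {..<?p}" for n
  proof
    have "(of_nat n :: 'a) = of_nat (n div ?p * ?p + n mod ?p)"
      by (simp only: div_mult_mod_eq)
    then show "(of_nat n :: 'a) = of_nat (n mod ?p)"
      by (simp only: of_nat_add of_nat_mult of_nat_CHAR mult_zero_right add_0)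
  qed (use p in auto)
  then have "(prime_field :: 'a set) = of_nat ` {..<?p}"
    by (auto simp: prime_field_def)
  moreover have "inj_on (of_nat :: nat \<Rightarrow> 'a) {..<?p}"
  proof (rule linorder_inj_onI')
    fix i j assume "i \<in> {..<?p}" "j \<in> {..<?p}" "i < j"
    then have "\<not> ?p dvd (j - i)"
      by (auto dest: dvd_imp_le)
    then have "of_nat (j - i) \<noteq> (0::'a)"
      by (simp only: of_nat_eq_0_iff_char_dvd not_False_eq_True)
    then show "(of_nat i :: 'a) \<noteq> of_nat j"
      using \<open>i < j\<close> by (simp add: of_nat_diff)
  qed
  ultimately show ?thesis
    by (metis card_image card_lessThan)
qed

text \<open>The polynomial X^p - X has at most p roots, and the p elements of the prime field are
  among them. The trace arguments work with this description as fixed points of Frobenius.\<close>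

lemma prime_field_eq: "(prime_field :: 'a::{field,finite} set) = {k. k ^ CHAR('a) = k}"
proof (rule card_subset_eq)
  let ?p = "CHAR('a)" and ?P = "monom 1 CHAR('a) - monom 1 1 :: 'a poly"
  have p: "?p > 1"
    by (rule prime_gt_1_nat[OF prime_CHAR_finite_field])
  then have "coeff ?P ?p = 1"
    by simp
  then have "?P \<noteq> 0"
    by (metis coeff_0 zero_neq_one)
  then have "card {x. poly ?P x = 0} \<le> degree ?P"
    by (rule card_poly_roots_bound)
  also have "degree ?P \<le> ?p"
    using p by (intro degree_diff_le degree_monom_le[THEN order_trans]) auto
  also have "{x. poly ?P x = 0} = {k. k ^ ?p = k}"
    by (auto simp: poly_monom)
  finally have le: "card {k::'a. k ^ ?p = k} \<le> ?p" .
  show sub: "prime_field \<subseteq> {k::'a. k ^ ?p = k}"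
    by (auto simp: prime_field_def of_nat_power_CHAR)
  show "card (prime_field :: 'a set) = card {k::'a. k ^ ?p = k}"
    using le card_mono[OF _ sub] by (simp add: card_prime_field)
qed simp

lemma prime_field_divide:
  fixes k l :: "'a::{field,finite}"
  assumes "k \<in> prime_field" "l \<in> prime_field"
  shows "k / l \<in> prime_field"
  using assms by (simp add: prime_field_eq power_divide)

lemma field_trace_add: "field_trace (x + y) = field_trace x + field_trace y"
  unfolding field_trace_def
  by (simp add: freshmans_dream'[OF prime_CHAR_finite_field refl] sum.distrib)

lemma field_trace_scale:
  assumes "k \<in> prime_field"
  shows "field_trace (k * x) = k * field_trace x"
proof -
  have "k ^ (CHAR('a) ^ i) = k" for i
    using assms by (induction i) (simp_all add: prime_field_eq power_mult)
  then show ?thesis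
    unfolding field_trace_def by (simp add: power_mult_distrib sum_distrib_left)
qed

locale prime_power_field =
  fixes ty :: "'a::{field,finite} itself" and m :: nat
  assumes CARD_eq: "CARD('a) = CHAR('a) ^ m"
begin

lemma multiplicity_eq: "multiplicity CHAR('a) CARD('a) = m"
  using CARD_eq prime_CHAR_finite_field[where 'a='a] by simp

text \<open>Frobenius permutes the summands of the trace cyclically, because the q-th power of
  \<open>x\<close> is \<open>x\<close>; so the trace is a fixed point.\<close>

lemma field_trace_in_prime_field: "field_trace (x::'a) \<in> prime_field"
proof -
  let ?p = "CHAR('a)"
  have "field_trace x ^ ?p = (\<Sum>i<m. x ^ (?p ^ Suc i))"
    unfolding field_trace_def multiplicity_eq
    by (simp add: freshmans_dream_sum[OF prime_CHAR_finite_field refl] power_mult[symmetric] mult.commute)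
  also have "\<dots> + x = (\<Sum>i<Suc m. x ^ (?p ^ i))"
    by (simp only: sum.lessThan_Suc_shift power_0 power_one_right add.commute)
  also have "\<dots> = field_trace x + x"
    unfolding field_trace_def multiplicity_eq using finite_field_power_CARD[of x] by (simp add: CARD_eq)
  finally show ?thesis
    by (simp add: prime_field_eq)
qed

text \<open>The trace is given by a polynomial with coefficient 1 at X and degree at most p^(m-1) <
  q, which cannot have all q elements as roots.\<close>

lemma field_trace_nonzero: "\<exists>x::'a. field_trace x \<noteq> 0"
proof (rule ccontr)
  assume "\<not> ?thesis"
  then have z: "field_trace x = 0" for x :: 'a by blast
  let ?p = "CHAR('a)"
  have p: "?p > 1"
    by (rule prime_gt_1_nat[OF prime_CHAR_finite_field])
  \<comment> \<open>For \<open>m = 0\<close> the trace would be the empty sum.\<close>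
  have "m \<noteq> 0"
  proof
    assume "m = 0"
    then have "CARD('a) = 1" using CARD_eq by simp
    then obtain a :: 'a where "UNIV = {a}" by (auto simp: card_1_singleton_iff)
    then have "(0::'a) = 1" by (metis UNIV_I singletonD)
    then show False by simp
  qed
  define P :: "'a poly" where "P = (\<Sum>i<m. monom 1 (?p ^ i))"
  have one: "?p ^ i = 1 \<longleftrightarrow> i = 0" for i
    using p by auto
  have "coeff P 1 = (\<Sum>i<m. if i = 0 then 1 else 0)"
    unfolding P_def coeff_sum coeff_monom using one by (intro sum.cong) auto
  also have "\<dots> = 1"
    using \<open>m \<noteq> 0\<close> by simp
  finally have "P \<noteq> 0"
    by (metis coeff_0 zero_neq_one)
  then have "card {x. poly P x = 0} \<le> degree P"
    by (rule card_poly_roots_bound)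
  moreover have "poly P x = 0" for x
    using z[of x] by (simp add: P_def poly_sum poly_monom field_trace_def multiplicity_eq)
  ultimately have "CARD('a) \<le> degree P"
    by simp
  also have "degree P \<le> ?p ^ (m - 1)"
    unfolding P_def using p
    by (intro degree_sum_le degree_monom_le[THEN order_trans] power_increasing) auto
  also have "\<dots> < ?p ^ m"
    using p \<open>m \<noteq> 0\<close> by (intro power_strict_increasing) auto
  finally show False
    using CARD_eq by simp
qed

end

section \<open>The trace-symplectic form\<close>

definition dvec_scale :: "'a::semiring_1 \<Rightarrow> ('a, 'n::finite) dvec \<Rightarrow> ('a, 'n) dvec" where
  "dvec_scale k v = (k *s fst v, k *s snd v)"

lemma dvec_scale_0 [simp]: "dvec_scale 0 v = 0"
  by (simp add: dvec_scale_def vec_eq_iff vector_scalar_mult_def prod_eq_iff)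

lemma dvec_scale_1 [simp]: "dvec_scale 1 v = v"
  by (simp add: dvec_scale_def vec_eq_iff vector_scalar_mult_def prod_eq_iff)

lemma dvec_scale_add_left: "dvec_scale (k + l) v = dvec_scale k v + dvec_scale l v"
  by (simp add: dvec_scale_def vec_eq_iff vector_scalar_mult_def prod_eq_iff algebra_simps)

lemma dvec_scale_minus_left:
  fixes v :: "('a::ring_1, 'n::finite) dvec"
  shows "dvec_scale (- k) v = - dvec_scale k v"
  by (simp add: dvec_scale_def vec_eq_iff vector_scalar_mult_def prod_eq_iff)

lemma additive_code_add:
  assumes "additive_code C" "u \<in> C" "v \<in> C"
  shows "u + v \<in> C"
  using assms unfolding additive_code_def by blast

lemma additive_code_diff:
  assumes "additive_code C" "u \<in> C" "v \<in> C"
  shows "u - v \<in> C"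
  using assms unfolding additive_code_def by (metis diff_conv_add_uminus)

lemma additive_code_scale:
  fixes C :: "('a::ring_1, 'n::finite) dvec set"
  assumes "additive_code C" "v \<in> C" "k \<in> prime_field"
  shows "dvec_scale k v \<in> C"
proof -
  have "dvec_scale (of_nat n) v \<in> C" for n
    using assms(1,2) by (induction n) (auto simp: dvec_scale_add_left additive_code_def)
  then show ?thesis
    using assms(3) by (auto simp: prime_field_def)
qed

lemma field_trace_0 [simp]: "field_trace 0 = 0"
  by (metis add_0 add_cancel_right_right field_trace_add)

lemma field_trace_minus: "field_trace (- x) = - field_trace x"
  using field_trace_add[of x "- x"] by (simp add: eq_neg_iff_add_eq_0 add.commute)

lemma trace_symplectic_skew: "trace_symplectic u v = - trace_symplectic v u"
proof -
  have "scalar_product x y = scalar_product y x" for x y :: "'a ^ 'n"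
    by (simp add: scalar_product_def mult.commute)
  then show ?thesis
    unfolding trace_symplectic_def by (metis field_trace_minus minus_diff_eq)
qed

lemma trace_symplectic_self [simp]: "trace_symplectic u u = 0"
  unfolding trace_symplectic_def by simp

lemma trace_symplectic_add_left:
  "trace_symplectic (u + u') v = trace_symplectic u v + trace_symplectic u' v"
  unfolding trace_symplectic_def
  by (simp add: scalar_product_def algebra_simps sum.distrib flip: field_trace_add)

lemma trace_symplectic_add_right:
  "trace_symplectic v (u + u') = trace_symplectic v u + trace_symplectic v u'"
  using trace_symplectic_add_left trace_symplectic_skew by (metis minus_add_distrib)

lemma trace_symplectic_scale_left:
  assumes "k \<in> prime_field"
  shows "trace_symplectic (dvec_scale k u) v = k * trace_symplectic u v"
  unfolding trace_symplectic_def
  by (simp add: scalar_product_def dvec_scale_def vector_scalar_mult_def sum_distrib_left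
      right_diff_distrib mult_ac flip: field_trace_scale[OF assms])

lemma trace_symplectic_scale_right:
  assumes "k \<in> prime_field"
  shows "trace_symplectic u (dvec_scale k v) = k * trace_symplectic u v"
  using trace_symplectic_scale_left[OF assms] trace_symplectic_skew by (metis mult_minus_right)

lemma trace_symplectic_zero_left [simp]: "trace_symplectic 0 v = 0"
  by (metis add_0 add_cancel_right_right trace_symplectic_add_left)

lemma trace_symplectic_minus_left: "trace_symplectic (- u) v = - trace_symplectic u v"
  using trace_symplectic_add_left[of u "- u" v]
  by (simp add: eq_neg_iff_add_eq_0 add.commute)

lemma trace_symplectic_eq_0_commute: "trace_symplectic u v = 0 \<longleftrightarrow> trace_symplectic v u = 0"
  using trace_symplectic_skew[of u v] by simp

lemma not_in_symplectic_dualI: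
  "v \<in> C \<Longrightarrow> trace_symplectic u v \<noteq> 0 \<Longrightarrow> u \<notin> symplectic_dual C"
  unfolding symplectic_dual_def by blast

lemma additive_code_symplectic_dual: "additive_code (symplectic_dual C)"
  unfolding additive_code_def symplectic_dual_def
  by (simp add: trace_symplectic_add_left trace_symplectic_minus_left)

text \<open>Vectors of the radical are orthogonal to \<open>C\<close>, and orthogonality is
  symmetric.\<close>

lemma subset_symplectic_dual_radical: "C \<subseteq> symplectic_dual (C \<inter> symplectic_dual C)"
  unfolding symplectic_dual_def using trace_symplectic_eq_0_commute by blast

lemma symplectic_dual_image:
  assumes "bij f" and "\<And>u v. trace_symplectic (f u) (f v) = trace_symplectic u v"
  shows "symplectic_dual (f ` C) = f ` symplectic_dual C"
proof (rule set_eqI)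
  fix u
  obtain u' where "u = f u'"
    using \<open>bij f\<close> by (metis bij_pointE)
  then show "u \<in> symplectic_dual (f ` C) \<longleftrightarrow> u \<in> f ` symplectic_dual C"
    using \<open>bij f\<close> assms(2) by (auto simp: symplectic_dual_def bij_def inj_image_mem_iff)
qed

text \<open>\<open>b\<close> is supported on coordinate \<open>i\<close> alone, so the supports of
  \<open>u\<close> and \<open>u + b\<close> agree elsewhere.\<close>

lemma swt_le_Suc_swt_add:
  fixes u b :: "('a::group_add, 'n::finite) dvec"
  assumes "\<And>j. j \<noteq> i \<Longrightarrow> fst b $ j = 0 \<and> snd b $ j = 0"
  shows "swt u \<le> Suc (swt (u + b))"
proof -
  have "{j. (fst u $ j, snd u $ j) \<noteq> (0, 0)} \<subseteq>
      insert i {j. (fst (u + b) $ j, snd (u + b) $ j) \<noteq> (0, 0)}"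
    using assms by force
  then have "swt u \<le> card (insert i {j. (fst (u + b) $ j, snd (u + b) $ j) \<noteq> (0, 0)})"
    unfolding swt_def by (intro card_mono) auto
  also have "\<dots> \<le> Suc (swt (u + b))"
    unfolding swt_def by (rule card_insert_le_m1) auto
  finally show ?thesis .
qed

context prime_power_field
begin

lemma trace_symplectic_in_prime_field:
  "trace_symplectic u (v :: ('a, 'n::finite) dvec) \<in> prime_field"
  unfolding trace_symplectic_def by (rule field_trace_in_prime_field)

text \<open>At a coordinate where one half of \<open>w\<close> is nonzero, the opposite half of
  \<open>b\<close> gets \<open>t\<close> divided by that entry, where \<open>t\<close> has nonzero
  trace; the product is then the trace of \<open>t\<close> or \<open>- t\<close>.\<close>

lemma ex_weight_one_not_orthogonal:
  fixes w :: "('a, 'n::finite) dvec"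
  assumes "w \<noteq> 0"
  obtains b i where "\<And>j. j \<noteq> i \<Longrightarrow> fst b $ j = 0 \<and> snd b $ j = 0"
    and "trace_symplectic w b \<noteq> 0"
proof -
  obtain t :: 'a where t: "field_trace t \<noteq> 0"
    using field_trace_nonzero by blast
  obtain i where "fst w $ i \<noteq> 0 \<or> snd w $ i \<noteq> 0"
    using assms by (auto simp: prod_eq_iff vec_eq_iff)
  then show thesis
  proof
    assume nz: "fst w $ i \<noteq> 0"
    let ?b = "(0, \<chi> j. if j = i then t / fst w $ i else 0) :: ('a, 'n) dvec"
    have "trace_symplectic w ?b = field_trace (- t)"
      using nz by (simp add: trace_symplectic_def scalar_product_def if_distrib cong: if_cong)
    then show thesis
      using t by (intro that[of i ?b]) (auto simp: field_trace_minus)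
  next
    assume nz: "snd w $ i \<noteq> 0"
    let ?b = "(\<chi> j. if j = i then t / snd w $ i else 0, 0) :: ('a, 'n) dvec"
    have "trace_symplectic w ?b = field_trace t"
      using nz by (simp add: trace_symplectic_def scalar_product_def if_distrib
          if_distribR cong: if_cong)
    then show thesis
      using t by (intro that[of i ?b]) auto
  qed
qed

text \<open>\<open>C\<close> is the direct sum of the prime-field line through \<open>y\<close> and
  the hyperplane orthogonal to \<open>x\<close>; \<open>?g\<close> is the coordinate along
  \<open>y\<close>.\<close>

lemma card_additive_code_hyperplane:
  fixes C :: "('a, 'n::finite) dvec set"
  assumes C: "additive_code C" and y: "y \<in> C" and xy: "trace_symplectic y x \<noteq> 0"
  shows "card C = CHAR('a) * card {v \<in> C. trace_symplectic v x = 0}"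
proof -
  let ?H = "{v \<in> C. trace_symplectic v x = 0}"
  let ?f = "\<lambda>(k, v). dvec_scale k y + v"
  let ?g = "\<lambda>u. trace_symplectic u x / trace_symplectic y x"
  have g: "?g u \<in> prime_field" for u
    by (intro prime_field_divide trace_symplectic_in_prime_field)
  have "bij_betw ?f (prime_field \<times> ?H) C"
  proof (rule bij_betw_byWitness[where f' = "\<lambda>u. (?g u, u - dvec_scale (?g u) y)"])
    show "\<forall>a\<in>prime_field \<times> ?H. (?g (?f a), ?f a - dvec_scale (?g (?f a)) y) = a"
      using xy by (auto simp: trace_symplectic_add_left trace_symplectic_scale_left)
    show "\<forall>u\<in>C. ?f (?g u, u - dvec_scale (?g u) y) = u"
      by simp
    show "?f ` (prime_field \<times> ?H) \<subseteq> C"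
      using additive_code_add[OF C additive_code_scale[OF C y]] by auto
    show "(\<lambda>u. (?g u, u - dvec_scale (?g u) y)) ` C \<subseteq> prime_field \<times> ?H"
    proof (intro image_subsetI SigmaI CollectI conjI)
      fix u assume "u \<in> C"
      then show "u - dvec_scale (?g u) y \<in> C"
        by (intro additive_code_diff[OF C] additive_code_scale[OF C y] g)
      have "trace_symplectic (u + dvec_scale (- ?g u) y) x = 0"
        using xy g[of u] unfolding trace_symplectic_add_left dvec_scale_minus_left
        by (simp add: trace_symplectic_minus_left trace_symplectic_scale_left)
      then show "trace_symplectic (u - dvec_scale (?g u) y) x = 0"
        by (simp add: dvec_scale_minus_left)
    qed (rule g)
  qed
  then have "card (prime_field \<times> ?H :: ('a \<times> ('a, 'n) dvec) set) = card C"
    by (rule bij_betw_same_card)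
  then show ?thesis
    by (simp add: card_cartesian_product card_prime_field)
qed

end

section \<open>Subsystem codes\<close>

lemma min_swt_in:
  assumes "S - {0} \<noteq> {}"
  obtains u where "u \<in> S" "u \<noteq> 0" "swt u = min_swt S"
proof -
  have "min_swt S \<in> swt ` (S - {0})"
    unfolding min_swt_def by (rule Min_in) (use assms in auto)
  then obtain u where "min_swt S = swt u" "u \<in> S - {0}"
    by (rule imageE)
  then show thesis
    using that[of u] by simp
qed

lemma min_swt_le:
  assumes "u \<in> S" "u \<noteq> 0"
  shows "min_swt S \<le> swt u"
  unfolding min_swt_def by (rule Min_le) (use assms in auto)

lemma min_swt_eqI:
  assumes "u \<in> S" "u \<noteq> 0" "swt u = d" "\<And>v. v \<in> S \<Longrightarrow> v \<noteq> 0 \<Longrightarrow> d \<le> swt v"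
  shows "min_swt S = d"
  unfolding min_swt_def by (rule Min_eqI) (use assms in auto)

lemma additive_code_image:
  assumes f: "\<And>u v. f (u + v) = f u + f v" and C: "additive_code C"
  shows "additive_code (f ` C)"
proof -
  have f0: "f 0 = 0"
    using f[of 0 0] by (metis add_0 add_cancel_right_right)
  have fm: "f (- u) = - f u" for u
    using f[of "- u" u] f0 by (simp add: eq_neg_iff_add_eq_0)
  show ?thesis
    using C f0 unfolding additive_code_def
    by (auto simp: image_iff f[symmetric] fm[symmetric])
qed

section \<open>Splitting off a hyperbolic pair\<close>

context prime_power_field
begin

text \<open>The vector \<open>u\<close> certifies the new distance: it avoids the smaller code
  because it is outside \<open>C\<close> already or because it is \<open>x\<close>, which the
  splitting removes. The bound \<open>low\<close> yields both minimality and purity.\<close>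

lemma pure_subsystem_code_two_hyperplanes:
  fixes C :: "('a, 'n::finite) dvec set"
  assumes code: "subsystem_code C K R d" and R: "CHAR('a) dvd R"
    and x: "x \<in> C" "x \<notin> symplectic_dual C"
    and u: "u \<in> symplectic_dual (C \<inter> symplectic_dual C)" "u \<notin> C \<or> u = x" "swt u = d"
    and low: "\<And>v. v \<in> symplectic_dual (C \<inter> symplectic_dual C) \<Longrightarrow> v \<noteq> 0 \<Longrightarrow> d \<le> swt v"
  shows "\<exists>C' :: ('a, 'n) dvec set. pure_subsystem_code C' (CHAR('a) * K) (R div CHAR('a)) d"
proof -
  let ?p = "CHAR('a)"
  define D where "D = C \<inter> symplectic_dual C"
  have C: "additive_code C" and K: "K > 0" and R0: "R > 0"
    and cardC: "real (card C) = real (CARD('a) ^ CARD('n)) * real R / real K"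
    and cardD: "real (card D) = real (CARD('a) ^ CARD('n)) / (real K * real R)"
    using code by (auto simp: subsystem_code_def D_def Let_def)
  have p: "?p > 0"
    by (simp add: finite_imp_CHAR_pos)
  obtain y where y: "y \<in> C" "trace_symplectic x y \<noteq> 0"
    using x by (auto simp: symplectic_dual_def)
  define C1 where "C1 = {v \<in> C. trace_symplectic v x = 0}"
  define C2 where "C2 = {v \<in> C1. trace_symplectic v y = 0}"
  have C1: "additive_code C1"
    using C unfolding additive_code_def C1_def
    by (auto simp: trace_symplectic_add_left trace_symplectic_minus_left)
  then have C2: "additive_code C2"
    unfolding additive_code_def C2_def
    by (auto simp: trace_symplectic_add_left trace_symplectic_minus_left)
  \<comment> \<open>Each cut has index p: \<open>y\<close> is not orthogonal to \<open>x\<close>,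
    and \<open>x\<close>, being orthogonal to itself, survives into \<open>C1\<close> but is not
    orthogonal to \<open>y\<close>.\<close>
  have "card C = ?p * card C1"
    unfolding C1_def using y trace_symplectic_eq_0_commute[of x y]
    by (intro card_additive_code_hyperplane[OF C]) auto
  also have "card C1 = ?p * card C2"
    unfolding C2_def using x y by (intro card_additive_code_hyperplane[OF C1]) (auto simp: C1_def)
  finally have card: "card C = ?p * (?p * card C2)" .
  have dual: "C2 \<inter> symplectic_dual C2 = D"
  proof
    show "D \<subseteq> C2 \<inter> symplectic_dual C2"
      using x y by (auto simp: D_def C2_def C1_def symplectic_dual_def)
    have "trace_symplectic v z = 0" if v: "v \<in> C2" "v \<in> symplectic_dual C2" and z: "z \<in> C" for v z
    proof -
      let ?a = "trace_symplectic x y" and ?k = "trace_symplectic z x" and ?l = "trace_symplectic z y"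
      have pf: "?k / ?a \<in> prime_field" "- ?l / ?a \<in> prime_field"
        by (intro prime_field_divide trace_symplectic_in_prime_field;
            simp add: trace_symplectic_skew[of z y] trace_symplectic_in_prime_field)+
      \<comment> \<open>The coefficients project \<open>z\<close> along \<open>x\<close> and
        \<open>y\<close> to a vector orthogonal to both. As \<open>v\<close> is orthogonal to
        \<open>?z\<close>, \<open>x\<close> and \<open>y\<close>, it is orthogonal to
        \<open>z\<close>.\<close>
      let ?z = "z + dvec_scale (?k / ?a) y + dvec_scale (- ?l / ?a) x"
      have mem: "?z \<in> C"
        by (intro additive_code_add[OF C] additive_code_scale[OF C] x y z pf)
      have "trace_symplectic ?z x = 0" "trace_symplectic ?z y = 0"
        using y pf trace_symplectic_skew[of y x]
        by (simp_all only: trace_symplectic_add_left trace_symplectic_scale_left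
            trace_symplectic_self) (simp_all add: field_simps)
      then have "?z \<in> C2"
        using mem by (simp add: C2_def C1_def)
      then have "trace_symplectic v ?z = 0"
        using v by (simp add: symplectic_dual_def)
      moreover have "trace_symplectic v x = 0" "trace_symplectic v y = 0"
        using v by (simp_all add: C2_def C1_def)
      ultimately show ?thesis
        using pf by (simp add: trace_symplectic_add_right trace_symplectic_scale_right)
    qed
    then have "v \<in> symplectic_dual C" if "v \<in> C2" "v \<in> symplectic_dual C2" for v
      unfolding symplectic_dual_def[of C] using that by simp
    then show "C2 \<inter> symplectic_dual C2 \<subseteq> D"
      unfolding D_def C2_def C1_def by blast
  qed
  have xC2: "x \<notin> C2"
    using y by (simp add: C2_def)
  have sub: "C2 \<subseteq> C" "C \<subseteq> symplectic_dual D"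
    using subset_symplectic_dual_radical by (auto simp: C2_def C1_def D_def)
  \<comment> \<open>0 lies in \<open>C\<close> and in its dual, whereas \<open>u\<close> is outside
    \<open>C\<close> or equals \<open>x\<close>, which is outside the dual.\<close>
  have "u \<noteq> 0"
    using u C x additive_code_symplectic_dual[of C] by (auto simp: additive_code_def)
  then have "min_swt (symplectic_dual D - C2) = d"
    using u low xC2 sub unfolding D_def[symmetric] by (intro min_swt_eqI[of u]) auto
  \<comment> \<open>\<open>x\<close> separates the two sets, so the first clause of the distance
    applies to the new code.\<close>
  moreover have "symplectic_dual D \<noteq> C2"
    using xC2 x sub by auto
  \<comment> \<open>Dividing |C| by p^2 matches dividing R/K by p^2; the product KR, and with it
    |D|, is unchanged.\<close>
  moreover have "real (card C2) = real (CARD('a) ^ CARD('n)) * real (R div ?p) / real (?p * K)"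
    using cardC p K R unfolding card by (auto simp: field_simps real_of_nat_div)
  moreover have "real (card D) = real (CARD('a) ^ CARD('n)) / (real (?p * K) * real (R div ?p))"
    using cardD p R by (auto simp: field_simps real_of_nat_div)
  moreover have "?p * K > 0" "R div ?p > 0"
    using p K R R0 by (auto elim!: dvdE)
  ultimately have "subsystem_code C2 (?p * K) (R div ?p) d"
    using C2 unfolding subsystem_code_def dual Let_def by simp
  moreover have "pure_to C2 d"
    using low sub unfolding pure_to_def D_def[symmetric] by (meson linorder_not_le subsetD)
  ultimately show ?thesis
    unfolding pure_subsystem_code_def by blast
qed

section \<open>An isometry moving a vector out of the radical\<close>

lemma trace_symplectic_nondegenerate:
  fixes u :: "('a, 'n::finite) dvec"
  assumes "\<And>v. trace_symplectic u v = 0"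
  shows "u = 0"
  using ex_weight_one_not_orthogonal[of u] assms by metis

text \<open>Needed when \<open>C\<close> is the dual of its radical and the radical holds all its
  vectors of weight \<open>d\<close>: every split code contains the radical, so splitting
  \<open>C\<close> directly would raise the distance.\<close>

lemma ex_isometry_moving_out_of_radical:
  fixes C :: "('a, 'n::finite) dvec set"
  assumes C: "additive_code C" and ne: "\<not> C \<subseteq> symplectic_dual C"
    and w: "w \<in> C" "w \<in> symplectic_dual C" "w \<noteq> 0"
    and low: "\<And>v. v \<in> C \<Longrightarrow> v \<noteq> 0 \<Longrightarrow> d \<le> swt v"
    and low': "\<And>v. v \<in> C \<Longrightarrow> v \<notin> symplectic_dual C \<Longrightarrow> d < swt v"
  obtains f :: "('a, 'n) dvec \<Rightarrow> ('a, 'n) dvec" where "bij f" "\<forall>u v. f (u + v) = f u + f v"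
    "\<forall>u v. trace_symplectic (f u) (f v) = trace_symplectic u v"
    "w \<in> f ` C" "w \<notin> symplectic_dual (f ` C)"
    "\<forall>v\<in>f ` C. v \<noteq> 0 \<longrightarrow> d \<le> swt v"
proof -
  obtain b i where b: "\<And>j. j \<noteq> i \<Longrightarrow> fst b $ j = 0 \<and> snd b $ j = 0" "trace_symplectic w b \<noteq> 0"
    using ex_weight_one_not_orthogonal[OF w(3)] by metis
  obtain c0 where c0: "c0 \<in> C" "c0 \<notin> symplectic_dual C"
    using ne by blast
  \<comment> \<open>This multiple of \<open>w\<close> makes \<open>c\<close> orthogonal to
    \<open>b\<close>; since \<open>w\<close> is in the radical, \<open>c\<close> pairs with
    \<open>C\<close> exactly as \<open>c0\<close> does.\<close>
  let ?t = "- (trace_symplectic c0 b / trace_symplectic w b)"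
  have t: "?t \<in> prime_field"
    using prime_field_divide[OF trace_symplectic_in_prime_field[of "- c0" b]
        trace_symplectic_in_prime_field[of w b]] by (simp add: trace_symplectic_minus_left)
  define c where "c = c0 + dvec_scale ?t w"
  have c: "c \<in> C"
    unfolding c_def by (intro additive_code_add[OF C] additive_code_scale[OF C] c0 w t)
  have cb: "trace_symplectic c b = 0"
    using b unfolding c_def trace_symplectic_add_left trace_symplectic_scale_left[OF t] by simp
  have w0: "trace_symplectic w v = 0" if "v \<in> C" for v
    using w that by (simp add: symplectic_dual_def)
  obtain z where z0: "z \<in> C" "trace_symplectic c0 z \<noteq> 0"
    using c0 by (auto simp: symplectic_dual_def)
  then have "trace_symplectic c z \<noteq> 0"
    using w0 unfolding c_def trace_symplectic_add_left trace_symplectic_scale_left[OF t] by simp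
  then have z: "z \<in> C" "trace_symplectic z c \<noteq> 0"
    using z0 by (simp_all add: trace_symplectic_eq_0_commute[of z c])

  text \<open>On \<open>C\<close> this is a shift inside \<open>C\<close> along \<open>c\<close>, followed by a change of a single coordinate
    for the vectors that are not orthogonal to \<open>c\<close>. Those lie outside the radical and therefore
    have weight to spare.\<close>
  define f where
    "f v = v + dvec_scale (trace_symplectic v b) c + dvec_scale (trace_symplectic v c) b" for v
  have add: "f (u + v) = f u + f v" for u v
    by (simp add: f_def trace_symplectic_add_left dvec_scale_add_left)
  have bc: "trace_symplectic b c = 0"
    using cb trace_symplectic_eq_0_commute by blast
  \<comment> \<open>\<open>f\<close> is the transvection along \<open>b + c\<close> composed with
    the inverse transvections along \<open>b\<close> and \<open>c\<close>. The mixed terms cancel by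
    skew symmetry, and the rest vanish because \<open>b\<close> and \<open>c\<close> are
    orthogonal.\<close>
  have iso: "trace_symplectic (f u) (f v) = trace_symplectic u v" for u v
    unfolding f_def trace_symplectic_add_left trace_symplectic_add_right
      trace_symplectic_scale_left[OF trace_symplectic_in_prime_field]
      trace_symplectic_scale_right[OF trace_symplectic_in_prime_field]
      cb bc trace_symplectic_self trace_symplectic_skew[of c v] trace_symplectic_skew[of b v]
    by (simp add: algebra_simps)
  \<comment> \<open>An isometry of a nondegenerate form is injective.\<close>
  have "inj f"
  proof (rule injI)
    fix u v assume "f u = f v"
    then have "trace_symplectic u z = trace_symplectic v z" for z
      by (metis iso)
    then have "trace_symplectic (u + - v) z = 0" for z
      by (simp only: trace_symplectic_add_left trace_symplectic_minus_left add.right_inverse)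
    then show "u = v"
      using trace_symplectic_nondegenerate[of "u + - v"] by simp
  qed
  then have "bij f"
    by (simp add: bij_def finite_UNIV_inj_surj)
  moreover have "w \<in> f ` C"
  proof
    \<comment> \<open>As \<open>w\<close> and \<open>b\<close> are orthogonal to \<open>c\<close>,
      \<open>f\<close> adds back exactly the multiple of \<open>c\<close> subtracted here.\<close>
    let ?v = "w + dvec_scale (trace_symplectic (- w) b) c"
    show "?v \<in> C"
      by (intro additive_code_add[OF C] additive_code_scale[OF C] w c trace_symplectic_in_prime_field)
    have "trace_symplectic ?v b = trace_symplectic w b" "trace_symplectic ?v c = 0"
      using cb w0[OF c] by (simp_all add: trace_symplectic_add_left
          trace_symplectic_scale_left[OF trace_symplectic_in_prime_field])
    then show "w = f ?v"
      by (simp add: f_def trace_symplectic_minus_left dvec_scale_minus_left)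
  qed
  \<comment> \<open>Only the multiple of \<open>b\<close> in \<open>f z\<close> pairs nontrivially
    with \<open>w\<close>, since \<open>z\<close> and \<open>c\<close> lie in
    \<open>C\<close>.\<close>
  moreover have "trace_symplectic w (f z) \<noteq> 0"
    using z b w0[OF c] w0[OF z(1)] by (simp add: f_def trace_symplectic_add_right
        trace_symplectic_scale_right[OF trace_symplectic_in_prime_field])
  then have "w \<notin> symplectic_dual (f ` C)"
    using z by (intro not_in_symplectic_dualI[of "f z"]) auto
  moreover have "d \<le> swt (f v)" if v: "v \<in> C" "f v \<noteq> 0" for v
  proof -
    define u where "u = v + dvec_scale (trace_symplectic v b) c"
    have u: "u \<in> C"
      unfolding u_def
      by (intro additive_code_add[OF C] additive_code_scale[OF C] v c trace_symplectic_in_prime_field)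
    have fv: "f v = u + dvec_scale (trace_symplectic v c) b"
      by (simp add: f_def u_def)
    have uc: "trace_symplectic u c = trace_symplectic v c"
      by (simp add: u_def trace_symplectic_add_left
          trace_symplectic_scale_left[OF trace_symplectic_in_prime_field])
    show ?thesis
    proof (cases "trace_symplectic v c = 0")
      case True
      then show ?thesis
        using low[OF u] v fv by simp
    next
      case False
      then have "u \<notin> symplectic_dual C"
        using uc by (intro not_in_symplectic_dualI[OF c]) simp
      then have "d < swt u"
        by (rule low'[OF u])
      also have "swt u \<le> Suc (swt (f v))"
        unfolding fv by (rule swt_le_Suc_swt_add[of i])
          (use b in \<open>auto simp: dvec_scale_def vector_scalar_mult_def\<close>)
      finally show ?thesis
        by simp
    qed
  qed
  ultimately show thesis
    using that[of f] add iso by blast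
qed

section \<open>Trading a factor p of R for one of K\<close>

lemma ex_pure_subsystem_code_trade:
  fixes C :: "('a, 'n::finite) dvec set"
  assumes pure: "pure_subsystem_code C K R d" and R: "CHAR('a) dvd R" "R > 1"
  shows "\<exists>C' :: ('a, 'n) dvec set. pure_subsystem_code C' (CHAR('a) * K) (R div CHAR('a)) d"
proof -
  define D where "D = C \<inter> symplectic_dual C"
  have code: "subsystem_code C K R d" and pd: "\<And>v. v \<in> C \<Longrightarrow> v \<noteq> 0 \<Longrightarrow> d \<le> swt v"
    using pure by (auto simp: pure_subsystem_code_def pure_to_def not_less)
  then have C: "additive_code C" and K: "K > 0"
    and cardC: "real (card C) = real (CARD('a) ^ CARD('n)) * real R / real K"
    and cardD: "real (card D) = real (CARD('a) ^ CARD('n)) / (real K * real R)"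
    and d: "d = (if symplectic_dual D \<noteq> C then min_swt (symplectic_dual D - C)
             else min_swt (symplectic_dual D))"
    by (auto simp: subsystem_code_def D_def Let_def)
  \<comment> \<open>The quotient |C|/|D| is R^2, which exceeds 1.\<close>
  have "C \<noteq> D"
  proof
    assume "C = D"
    then have "real R * real R = 1"
      using cardC cardD K R(2) by (simp add: field_simps)
    then show False
      using R(2) by (metis less_1_mult of_nat_1 of_nat_eq_iff of_nat_mult order_less_irrefl)
  qed
  then obtain x where x: "x \<in> C" "x \<notin> symplectic_dual C"
    by (auto simp: D_def)
  have sub: "C \<subseteq> symplectic_dual D"
    unfolding D_def by (rule subset_symplectic_dual_radical)
  have zero: "0 \<in> C" "0 \<in> symplectic_dual C"
    using C additive_code_symplectic_dual[of C] by (auto simp: additive_code_def)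
  show ?thesis
  proof (cases "symplectic_dual D = C")
    case False
    then have "symplectic_dual D - C - {0} \<noteq> {}"
      using sub zero by auto
    then obtain u where u: "u \<in> symplectic_dual D - C" "swt u = d"
      using min_swt_in False d by metis
    \<comment> \<open>Purity gives the bound inside \<open>C\<close>, the definition of the distance
      outside it.\<close>
    have "d \<le> swt v" if "v \<in> symplectic_dual D" "v \<noteq> 0" for v
      using that pd[of v] min_swt_le[of v "symplectic_dual D - C"] False d by (cases "v \<in> C") auto
    then show ?thesis
      using pure_subsystem_code_two_hyperplanes[OF code R(1) x, of u] u unfolding D_def by auto
  next
    case True
    show ?thesis
    proof (cases "\<exists>u\<in>C. u \<notin> symplectic_dual C \<and> swt u = d")
      case True
      then obtain u where u: "u \<in> C" "u \<notin> symplectic_dual C" "swt u = d"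
        by blast
      then show ?thesis
        using pure_subsystem_code_two_hyperplanes[OF code R(1) u(1,2), of u]
          \<open>symplectic_dual D = C\<close> pd unfolding D_def by auto
    next
      case False
      have "C - {0} \<noteq> {}"
        using x zero by auto
      \<comment> \<open>Here the dual of \<open>D\<close> is \<open>C\<close>, so \<open>d\<close>
        is the minimum weight of \<open>C\<close> itself and is attained in
        \<open>C\<close>.\<close>
      then obtain w where w: "w \<in> C" "w \<noteq> 0" "swt w = d"
        using min_swt_in True d by metis
      have low': "d < swt v" if "v \<in> C" "v \<notin> symplectic_dual C" for v
        using False pd[of v] that zero by (metis le_neq_implies_less)
      have wC: "w \<in> symplectic_dual C"
        using False w by blast
      have ne: "\<not> C \<subseteq> symplectic_dual C"
        using x by blast
      obtain f :: "('a, 'n) dvec \<Rightarrow> ('a, 'n) dvec"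
        where f: "bij f" "\<forall>u v. f (u + v) = f u + f v"
          "\<forall>u v. trace_symplectic (f u) (f v) = trace_symplectic u v"
          "w \<in> f ` C" "w \<notin> symplectic_dual (f ` C)"
          "\<forall>v\<in>f ` C. v \<noteq> 0 \<longrightarrow> d \<le> swt v"
        by (rule ex_isometry_moving_out_of_radical[OF C ne w(1) wC w(2) pd low'])
      note dual_image = symplectic_dual_image[OF f(1) f(3)[rule_format]]
      have inj: "inj f"
        using f(1) by (rule bij_is_inj)
      \<comment> \<open>The isometry carries radical to radical and keeps the code equal to the dual
        of its radical, so the second clause of the distance applies to the image too.\<close>
      have D': "f ` C \<inter> symplectic_dual (f ` C) = f ` D"
        unfolding dual_image D_def image_Int[OF inj] ..
      have dual: "symplectic_dual (f ` D) = f ` C"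
        using True by (simp add: dual_image)
      have "min_swt (f ` C) = d"
        by (rule min_swt_eqI[OF f(4) w(2,3) f(6)[rule_format]])
      moreover have "card (f ` C) = card C" "card (f ` D) = card D"
        using inj by (auto intro: card_image inj_on_subset)
      ultimately have code': "subsystem_code (f ` C) K R d"
        using cardC cardD K R(2) additive_code_image[OF f(2)[rule_format] C]
        unfolding subsystem_code_def D' dual Let_def by simp
      show ?thesis
        using pure_subsystem_code_two_hyperplanes[OF code' R(1) f(4,5), of w]
          f(4,6) w(3) unfolding D' dual by blast
    qed
  qed
qed

end

theorem theorem12:
  fixes q p m K R d :: nat
  assumes "prime p" and "q = p ^ m" and "CARD('a::{field,finite}) = q"
    and "R > 1"
    and "\<exists>C :: ('a, 'n::finite) dvec set. pure_subsystem_code C K R d"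
  shows "p dvd R \<and>
    (\<exists>C' :: ('a, 'n) dvec set. pure_subsystem_code C' (p * K) (R div p) d)"
proof -
  \<comment> \<open>The characteristic is a prime dividing q, hence equal to
    \<open>p\<close>.\<close>
  have "CHAR('a) dvd p ^ m"
    using CHAR_dvd_CARD_finite[where 'a='a] assms by simp
  then have p: "CHAR('a) = p"
    using prime_CHAR_finite_field[where 'a='a] \<open>prime p\<close> primes_dvd_imp_eq
    by (metis prime_dvd_power)
  interpret prime_power_field "TYPE('a)" m
    by standard (use assms p in simp)
  obtain C :: "('a, 'n) dvec set" where C: "pure_subsystem_code C K R d"
    using assms by blast
  then have K: "K > 0" and "real (card (C \<inter> symplectic_dual C)) =
      real (CARD('a) ^ CARD('n)) / (real K * real R)"
    by (auto simp: pure_subsystem_code_def subsystem_code_def Let_def)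
  \<comment> \<open>Clearing denominators makes \<open>R\<close> a divisor of q^n, hence a power of
    \<open>p\<close>; as \<open>R > 1\<close>, its exponent is positive.\<close>
  then have "real (card (C \<inter> symplectic_dual C)) * real K * real R = real (CARD('a) ^ CARD('n))"
    using \<open>R > 1\<close> by simp
  then have "card (C \<inter> symplectic_dual C) * K * R = CARD('a) ^ CARD('n)"
    by (simp only: of_nat_mult[symmetric] of_nat_eq_iff)
  then have "R dvd p ^ (m * CARD('n))"
    using assms by (metis dvd_triv_right power_mult)
  then obtain k where "R = p ^ k"
    using \<open>prime p\<close> divides_primepow_nat by blast
  then have "p dvd R"
    using \<open>R > 1\<close> by (cases k) auto
  then show ?thesis
    using ex_pure_subsystem_code_trade[OF C] \<open>R > 1\<close> unfolding p by blast
qed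

end
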